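(* Let $(\Omega,\mu)$ be a complete $\sigma$-finite measure space and let $\Phi_1,\Phi_2,\Phi_3$ be Young functions. Suppose there exists a positive constant $C$ such that, for all $u\in(0,\infty)$, $$\Phi_1^{-1}(u)\,\Phi_3^{-1}(u)\le C\,\Phi_2^{-1}(u).$$ Then, for all $f\in \mathrm{w}L^{\Phi_1}(\Omega)$ and $g\in \mathrm{w}L^{\Phi_3}(\Omega)$, $$\|fg\|_{\mathrm{w}L^{\Phi_2}(\Omega)}\le 4C\,\|f\|_{\mathrm{w}L^{\Phi_1}(\Omega)}\|g\|_{\mathrm{w}L^{\Phi_3}(\Omega)}.$$ Consequently, $\mathrm{w}L^{\Phi_3}(\Omega)\subset \mathrm{PWM}(\mathrm{w}L^{\Phi_1}(\Omega),\mathrm{w}L^{\Phi_2}(\Omega))$, and, for all $g\in \mathrm{w}L^{\Phi_3}(\Omega)$, $$\|g\|_{\mathrm{PWM}(\mathrm{w}L^{\Phi_1}(\Omega),\mathrm{w}L^{\Phi_2}(\Omega))}\le 4C\,\|g\|_{\mathrm{w}L^{\Phi_3}(\Omega)}.$$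
   Context: $L^0(\Omega)$ is the set of all measurable functions from $\Omega$ to $\mathbb{R}$ or $\mathbb{C}$ (functions equal a.e. are identified). The convention $0\cdot\infty=0$ is used. Young functions. "Increasing" means nondecreasing. For an increasing function $\Phi:[0,\infty]\to[0,\infty]$ let $a(\Phi)=\sup\{t\ge0:\Phi(t)=0\}$ and $b(\Phi)=\inf\{t\ge0:\Phi(t)=\infty\}$, with $\sup\emptyset=0$, $\inf\emptyset=\infty$. $\Phi$ is a Young function if: $0\le a(\Phi)<\infty$ and $0<b(\Phi)\le\infty$; $\lim_{t\to+0}\Phi(t)=\Phi(0)=0$; $\Phi$ is convex on $[0,b(\Phi))$; if $b(\Phi)=\infty$ then $\lim_{t\to\infty}\Phi(t)=\Phi(\infty)=\infty$; if $b(\Phi)<\infty$ then $\lim_{t\to b(\Phi)-0}\Phi(t)=\Phi(b(\Phi))\ (\le\infty)$. Generalized inverse: $\Phi^{-1}(u)=\inf\{t\ge0:\Phi(t)>u\}$ for $u\in[0,\infty)$, and $\Phi^{-1}(\infty)=\infty$. Weak Orlicz space: for $f\in L^0(\Omega)$ and $t\ge 0$ let $\mu(f,t)=\mu(\{x\in\Omega:|f(x)|>t\})$. Then $$\mathrm{w}L^{\Phi}(\Omega)=\Big\{f\in L^0(\Omega):\sup_{t\in(0,\infty)}\Phi(t)\,\mu(\epsilon f,t)<\infty\text{ for some }\epsilon>0\Big\},$$ $$\|f\|_{\mathrm{w}L^{\Phi}(\Omega)}=\inf\Big\{\lambda>0:\sup_{t\in(0,\infty)}\Phi(t)\,\mu(f/\lambda,t)\le1\Big\},$$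 which is a quasi-norm. Pointwise multipliers: for subspaces $E_1,E_2\subset L^0(\Omega)$, $\mathrm{PWM}(E_1,E_2)$ is the set of all $g\in L^0(\Omega)$ such that $fg\in E_2$ for every $f\in E_1$. When $E_1,E_2$ are quasi-normed, $\|g\|_{\mathrm{PWM}(E_1,E_2)}$ denotes the operator norm of $f\mapsto fg$, i.e. the infimum of the $K\ge0$ such that $\|fg\|_{E_2}\le K\|f\|_{E_1}$ for all $f\in E_1$. *)

theory Defs
  imports "HOL-Analysis.Analysis"
begin

text \<open>
  The interval \<open>[0,\<infinity>]\<close> is the type \<^typ>\<open>ennreal\<close>; there \<open>0 * \<infinity> = 0\<close>, \<open>Sup {} = 0\<close> and
  \<open>Inf {} = \<infinity>\<close>, which are exactly the conventions needed below.
\<close>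

definition young_a :: "(ennreal \<Rightarrow> ennreal) \<Rightarrow> ennreal" where
  "young_a \<Phi> = Sup {t. \<Phi> t = 0}"

definition young_b :: "(ennreal \<Rightarrow> ennreal) \<Rightarrow> ennreal" where
  "young_b \<Phi> = Inf {t. \<Phi> t = \<infinity>}"

text \<open>
  In the convexity clause, \<^const>\<open>enn2real\<close> loses nothing: \<open>\<Phi> t < \<infinity>\<close> whenever \<open>t < young_b \<Phi>\<close>.
\<close>

definition young_function :: "(ennreal \<Rightarrow> ennreal) \<Rightarrow> bool" where
  "young_function \<Phi> \<longleftrightarrow>
     mono \<Phi> \<and>
     young_a \<Phi> < \<infinity> \<and> 0 < young_b \<Phi> \<and>
     \<Phi> 0 = 0 \<and> (\<Phi> \<longlongrightarrow> 0) (at_right 0) \<and>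
     convex_on {t::real. 0 \<le> t \<and> ennreal t < young_b \<Phi>} (\<lambda>t. enn2real (\<Phi> (ennreal t))) \<and>
     (young_b \<Phi> = \<infinity> \<longrightarrow> \<Phi> \<infinity> = \<infinity> \<and> (\<Phi> \<longlongrightarrow> \<infinity>) (at_left \<infinity>)) \<and>
     (young_b \<Phi> < \<infinity> \<longrightarrow> (\<Phi> \<longlongrightarrow> \<Phi> (young_b \<Phi>)) (at_left (young_b \<Phi>)))"

definition gen_inverse :: "(ennreal \<Rightarrow> ennreal) \<Rightarrow> ennreal \<Rightarrow> ennreal" where
  "gen_inverse \<Phi> u = Inf {t. \<Phi> t > u}"

text \<open>The separate convention \<open>\<Phi>\<^sup>-\<^sup>1(\<infinity>) = \<infinity>\<close> is the case \<open>Inf {}\<close>.\<close>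

lemma gen_inverse_infinity: "gen_inverse \<Phi> \<infinity> = \<infinity>"
  by (simp add: gen_inverse_def)

text \<open>
  Scalars are a type of class \<open>{real_normed_field, euclidean_space}\<close>, i.e. the real or the complex
  numbers. Functions are not quotiented by a.e. equality: every notion below depends only on
  the a.e. class of the functions involved.
\<close>

definition distribution_fun ::
    "'a measure \<Rightarrow> ('a \<Rightarrow> 'k::{real_normed_field, euclidean_space}) \<Rightarrow> real \<Rightarrow> ennreal" where
  "distribution_fun M f t = emeasure M {x \<in> space M. norm (f x) > t}"

definition weak_modular ::
    "'a measure \<Rightarrow> (ennreal \<Rightarrow> ennreal) \<Rightarrow> ('a \<Rightarrow> 'k::{real_normed_field, euclidean_space}) \<Rightarrow> ennreal"
  where "weak_modular M \<Phi> f = (SUP t\<in>{0<..}. \<Phi> (ennreal t) * distribution_fun M f t)"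

definition weak_orlicz ::
    "'a measure \<Rightarrow> (ennreal \<Rightarrow> ennreal) \<Rightarrow> ('a \<Rightarrow> 'k::{real_normed_field, euclidean_space}) set"
  where "weak_orlicz M \<Phi> =
    {f \<in> borel_measurable M. \<exists>\<epsilon>>0. weak_modular M \<Phi> (\<lambda>x. of_real \<epsilon> * f x) < \<infinity>}"

definition weak_orlicz_norm ::
    "'a measure \<Rightarrow> (ennreal \<Rightarrow> ennreal) \<Rightarrow> ('a \<Rightarrow> 'k::{real_normed_field, euclidean_space}) \<Rightarrow> ennreal"
  where "weak_orlicz_norm M \<Phi> f =
    Inf {ennreal l |l. l > 0 \<and> weak_modular M \<Phi> (\<lambda>x. f x / of_real l) \<le> 1}"

definition PWM ::
    "'a measure \<Rightarrow> ('a \<Rightarrow> 'k::{real_normed_field, euclidean_space}) set \<Rightarrow> ('a \<Rightarrow> 'k) set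
      \<Rightarrow> ('a \<Rightarrow> 'k) set" where
  "PWM M E1 E2 = {g \<in> borel_measurable M. \<forall>f\<in>E1. (\<lambda>x. f x * g x) \<in> E2}"

text \<open>\<open>N1\<close> and \<open>N2\<close> are the quasi-norms of the domain \<open>E1\<close> and of the target space.\<close>

definition PWM_norm ::
    "('a \<Rightarrow> 'k::{real_normed_field, euclidean_space}) set
      \<Rightarrow> (('a \<Rightarrow> 'k) \<Rightarrow> ennreal) \<Rightarrow> (('a \<Rightarrow> 'k) \<Rightarrow> ennreal) \<Rightarrow> ('a \<Rightarrow> 'k) \<Rightarrow> ennreal" where
  "PWM_norm E1 N1 N2 g =
    Inf {ennreal K |K. K \<ge> 0 \<and> (\<forall>f\<in>E1. N2 (\<lambda>x. f x * g x) \<le> ennreal K * N1 f)}"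

end

theory Submission
  imports Defs
begin

text \<open>
  Normalize \<open>f\<close> and \<open>g\<close> to weak modular at most 1. If \<open>0 < u < \<Phi>2 s\<close>, then \<open>2 * u < \<Phi>2 (3 * s)\<close>
  by convexity, so the hypothesis at \<open>2 * u\<close> bounds \<open>\<Phi>1\<^sup>-\<^sup>1(2 * u) * \<Phi>3\<^sup>-\<^sup>1(2 * u)\<close> by \<open>3 * C * s\<close>.
  Hence \<open>4 * C * s = a * b\<close> with \<open>\<Phi>1 a > 2 * u\<close> and \<open>\<Phi>3 b > 2 * u\<close>. Where \<open>\<bar>f * g\<bar> > 4 * C * s\<close>, either
  \<open>\<bar>f\<bar> > a\<close> or \<open>\<bar>g\<bar> > b\<close>, and each of these sets has measure at most \<open>1 / (2 * u)\<close>.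
\<close>

section \<open>Young functions and their generalized inverses\<close>

lemma young_function_mono: "young_function \<Phi> \<Longrightarrow> s \<le> t \<Longrightarrow> \<Phi> s \<le> \<Phi> t"
  by (auto simp: young_function_def mono_def)

lemma young_function_less_young_b:
  assumes "t < young_b \<Phi>"
  shows "\<Phi> t < \<infinity>"
proof -
  have "\<Phi> t \<noteq> \<infinity>"
    using assms Inf_lower[of t "{t. \<Phi> t = \<infinity>}"] by (auto simp: young_b_def)
  then show ?thesis
    by (simp add: less_top)
qed

lemma young_function_greater_young_b:
  assumes "young_function \<Phi>" and "young_b \<Phi> < t"
  shows "\<Phi> t = \<infinity>"
proof -
  obtain s where "\<Phi> s = \<infinity>" "s < t"
    using assms(2) unfolding young_b_def Inf_less_iff by auto
  with young_function_mono[OF assms(1), of s t] show ?thesis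
    by (simp add: top_unique)
qed

text \<open>The strict inequality leaves room for \<open>k * t = young_b \<Phi>\<close>, where convexity says nothing.\<close>

lemma young_function_scale:
  assumes "young_function \<Phi>" and "1 \<le> k" "k < c" "0 < t"
  shows "ennreal k * \<Phi> (ennreal t) \<le> \<Phi> (ennreal (c * t))"
proof (cases "ennreal (k * t) < young_b \<Phi>")
  case True
  define \<phi> where "\<phi> = (\<lambda>t. enn2real (\<Phi> (ennreal t)))"
  let ?S = "{t::real. 0 \<le> t \<and> ennreal t < young_b \<Phi>}"
  have conv: "convex_on ?S \<phi>" and zero: "\<phi> 0 = 0" and "0 < young_b \<Phi>"
    using assms(1) by (auto simp: young_function_def \<phi>_def)
  \<comment> \<open>Convexity is used on the segment from 0 to \<open>k * t\<close>, where
    \<open>t\<close> is the point of weight \<open>1/k\<close>; the term at 0 vanishes.\<close>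
  then have "\<phi> ((1 - 1/k) *\<^sub>R 0 + (1/k) *\<^sub>R (k * t)) \<le> (1 - 1/k) * \<phi> 0 + (1/k) * \<phi> (k * t)"
    using assms True by (intro convex_onD[OF conv]) auto
  then have real: "k * \<phi> t \<le> \<phi> (k * t)"
    using assms zero by (simp add: field_simps)
  have fin: "\<Phi> (ennreal (k * t)) < \<infinity>"
    by (rule young_function_less_young_b[OF True])
  have "t \<le> k * t"
    using assms by simp
  then have "\<Phi> (ennreal t) \<le> \<Phi> (ennreal (k * t))"
    by (intro young_function_mono[OF assms(1)] ennreal_leI)
  with fin have fin': "\<Phi> (ennreal t) < \<infinity>"
    by (rule order.strict_trans1[rotated])
  have "ennreal k * \<Phi> (ennreal t) = ennreal (k * \<phi> t)"
    using fin' assms by (simp add: \<phi>_def ennreal_mult)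
  also have "\<dots> \<le> ennreal (\<phi> (k * t))"
    using real by (rule ennreal_leI)
  also have "\<dots> = \<Phi> (ennreal (k * t))"
    using fin by (simp add: \<phi>_def)
  also have "\<dots> \<le> \<Phi> (ennreal (c * t))"
    using assms by (intro young_function_mono[OF assms(1)] ennreal_leI) auto
  finally show ?thesis .
next
  case False
  then have "young_b \<Phi> \<le> ennreal (k * t)"
    by simp
  also have "\<dots> < ennreal (c * t)"
    using assms by (intro ennreal_lessI) auto
  finally show ?thesis
    using young_function_greater_young_b[OF assms(1)] by simp
qed

text \<open>The limit 0 at 0 keeps \<Phi> below \<open>u\<close> on some interval to the right of 0,
  and monotonicity then pushes every point with \<Phi> above \<open>u\<close> beyond that interval.
  Positivity rules out the product of 0 and infinity when the two inverses are factored in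
  \<open>ennreal_factor_between\<close>.\<close>

lemma gen_inverse_pos:
  assumes "young_function \<Phi>" and "0 < u"
  shows "0 < gen_inverse \<Phi> u"
proof -
  have "(\<Phi> \<longlongrightarrow> 0) (at_right 0)"
    using assms(1) by (auto simp: young_function_def)
  then have "\<forall>\<^sub>F t in at_right 0. \<Phi> t < u"
    using assms(2) by (rule order_tendstoD)
  then obtain b where b: "0 < b" "\<And>t. 0 < t \<Longrightarrow> t < b \<Longrightarrow> \<Phi> t < u"
    using eventually_at_right[of "0::ennreal" 1] by auto
  obtain c where c: "0 < c" "c < b"
    using dense[OF b(1)] by auto
  have "c \<le> gen_inverse \<Phi> u"
    unfolding gen_inverse_def
  proof (rule Inf_greatest)
    fix t assume "t \<in> {t. u < \<Phi> t}"
    then have "\<not> \<Phi> t \<le> \<Phi> c"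
      using b(2)[OF c] by auto
    then show "c \<le> t"
      using young_function_mono[OF assms(1), of t c] by (meson le_cases)
  qed
  with c(1) show ?thesis
    by simp
qed

lemma gen_inverse_le:
  assumes "u < \<Phi> t"
  shows "gen_inverse \<Phi> u \<le> t"
  using assms by (auto simp: gen_inverse_def intro: Inf_lower)

text \<open>An infimum strictly below \<open>t\<close> is undercut by a point \<open>s < t\<close>
  with \<Phi> above \<open>u\<close>. Strictness matters: at the infimum itself \<Phi> may equal
  \<open>u\<close>.\<close>

lemma less_young_function:
  assumes "young_function \<Phi>" and "gen_inverse \<Phi> u < t"
  shows "u < \<Phi> t"
proof -
  obtain s where "u < \<Phi> s" "s < t"
    using assms(2) unfolding gen_inverse_def Inf_less_iff by auto
  with young_function_mono[OF assms(1), of s t] show ?thesis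
    by (simp add: less_imp_le order.strict_trans2)
qed

section \<open>Level sets and the weak modular\<close>

lemma weak_modular_le_iff:
  "weak_modular M \<Phi> f \<le> K \<longleftrightarrow>
    (\<forall>t>0. \<Phi> (ennreal t) * emeasure M {x \<in> space M. t < norm (f x)} \<le> K)"
  by (auto simp: weak_modular_def distribution_fun_def SUP_le_iff)

text \<open>A level \<open>t\<close> strictly above the generalized inverse at \<open>u\<close> has
  \<Phi> above \<open>u\<close> there, so \<open>u\<close> may replace \<Phi> in the modular bound
  at \<open>t\<close>.\<close>

lemma mult_emeasure_le_1:
  assumes "young_function \<Phi>" and "weak_modular M \<Phi> f \<le> 1" and "gen_inverse \<Phi> u < ennreal t"
    and "0 < t"
  shows "u * emeasure M {x \<in> space M. t < norm (f x)} \<le> 1"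
  using less_young_function[OF assms(1,3)] assms(2,4) unfolding weak_modular_le_iff
  by (meson less_imp_le mult_right_mono order_trans zero_le)

section \<open>Factoring a number strictly above a product\<close>

text \<open>The ratio \<open>d / (a * b)\<close> exceeds 1, and each factor is enlarged by its
  square root.\<close>

lemma real_factor_between:
  fixes a b d :: real
  assumes "0 < a" "0 < b" "a * b < d"
  obtains a' b' where "a < a'" "b < b'" "a' * b' = d"
proof
  let ?r = "sqrt (d / (a * b))"
  have "1 < d / (a * b)"
    using assms by simp
  then have r: "1 < ?r" "?r * ?r = d / (a * b)"
    by (simp_all only: real_sqrt_gt_1_iff real_sqrt_mult_self abs_of_pos order.strict_trans[OF zero_less_one])
  show "a < a * ?r" "b < b * ?r"
    using r assms by auto
  have "(a * ?r) * (b * ?r) = a * b * (?r * ?r)"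
    by (simp add: algebra_simps)
  then show "(a * ?r) * (b * ?r) = d"
    unfolding r(2) using assms by simp
qed

text \<open>A finite product of positive factors has finite factors, which reduces the claim to the
  reals.\<close>

lemma ennreal_factor_between:
  fixes a b :: ennreal and d :: real
  assumes "0 < a" "0 < b" "a * b < ennreal d"
  obtains a' b' where "a < ennreal a'" "b < ennreal b'" "0 < a'" "0 < b'" "a' * b' = d"
proof -
  have "a * b < \<infinity>"
    using assms(3) by (rule order.strict_trans) simp
  then have "a < \<infinity>" "b < \<infinity>"
    using assms(1,2) by (auto simp: ennreal_mult_less_top less_top)
  then obtain x y where xy: "a = ennreal x" "b = ennreal y" "0 \<le> x" "0 \<le> y"
    by (metis ennreal_cases infinity_ennreal_def less_irrefl)
  then have "0 < x" "0 < y" "x * y < d"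
    using assms by (auto simp: ennreal_mult[symmetric] ennreal_less_iff)
  then obtain a' b' where "x < a'" "y < b'" "a' * b' = d"
    by (rule real_factor_between)
  with \<open>0 < x\<close> \<open>0 < y\<close> show thesis
    by (intro that[of a' b']) (auto simp: xy ennreal_less_iff)
qed

section \<open>The modular of a product\<close>

lemma weak_modular_mult_le_1:
  fixes f g :: "'a \<Rightarrow> 'k::{real_normed_field, euclidean_space}"
  assumes "young_function \<Phi>1" "young_function \<Phi>2" "young_function \<Phi>3" and "0 < C"
    and inverse_le: "\<And>u. 0 < u \<Longrightarrow> u < \<infinity> \<Longrightarrow>
      gen_inverse \<Phi>1 u * gen_inverse \<Phi>3 u \<le> ennreal C * gen_inverse \<Phi>2 u"
    and [measurable]: "f \<in> borel_measurable M" "g \<in> borel_measurable M"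
    and "weak_modular M \<Phi>1 f \<le> 1" "weak_modular M \<Phi>3 g \<le> 1"
  shows "weak_modular M \<Phi>2 (\<lambda>x. f x * g x / of_real (4 * C)) \<le> 1"
  unfolding weak_modular_le_iff
proof (intro allI impI)
  fix s :: real assume "0 < s"
  define E where "E = {x \<in> space M. s < norm (f x * g x / of_real (4 * C))}"
  \<comment> \<open>Working strictly below \<open>\<Phi>2 s\<close> keeps \<open>u\<close> finite,
    as \<open>inverse_le\<close> demands, even if \<open>\<Phi>2 s\<close> is infinite.\<close>
  have bound: "u * emeasure M E \<le> 1" if u: "0 < u" "u < \<Phi>2 (ennreal s)" for u
  proof -
    have "u < \<infinity>"
      using u(2) by (rule order.strict_trans2) simp
    have "ennreal 2 * u < ennreal 2 * \<Phi>2 (ennreal s)"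
      using u by (intro ennreal_mult_strict_left_mono) auto
    \<comment> \<open>The factor 3 lies strictly between 2, as \<open>young_function_scale\<close>
      demands, and 4, so that \<open>3 * C * s\<close> stays strictly below
      \<open>4 * C * s\<close>.\<close>
    also have "\<dots> \<le> \<Phi>2 (ennreal (3 * s))"
      using assms(2) \<open>0 < s\<close> by (intro young_function_scale) auto
    finally have le: "gen_inverse \<Phi>2 (2 * u) \<le> ennreal (3 * s)"
      by (intro gen_inverse_le) simp
    have "0 < 2 * u" "2 * u < \<infinity>"
      using u \<open>u < \<infinity>\<close> by (auto simp: ennreal_mult_less_top ennreal_zero_less_mult_iff)
    then have "gen_inverse \<Phi>1 (2 * u) * gen_inverse \<Phi>3 (2 * u) \<le> ennreal C * gen_inverse \<Phi>2 (2 * u)"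
      by (rule inverse_le)
    also have "\<dots> \<le> ennreal C * ennreal (3 * s)"
      by (intro mult_left_mono le) simp
    also have "\<dots> < ennreal (4 * C * s)"
      using \<open>0 < C\<close> \<open>0 < s\<close> by (simp add: ennreal_mult[symmetric] ennreal_less_iff)
    finally have "gen_inverse \<Phi>1 (2 * u) * gen_inverse \<Phi>3 (2 * u) < ennreal (4 * C * s)" .
    with gen_inverse_pos[OF assms(1) \<open>0 < 2 * u\<close>] gen_inverse_pos[OF assms(3) \<open>0 < 2 * u\<close>]
    obtain a b where
      ab: "gen_inverse \<Phi>1 (2 * u) < ennreal a" "gen_inverse \<Phi>3 (2 * u) < ennreal b"
        "0 < a" "0 < b" "a * b = 4 * C * s"
      by (rule ennreal_factor_between)
    define F where "F = {x \<in> space M. a < norm (f x)}"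
    define G where "G = {x \<in> space M. b < norm (g x)}"
    have [measurable]: "F \<in> sets M" "G \<in> sets M"
      by (auto simp: F_def G_def)
    have "E \<subseteq> F \<union> G"
    proof
      fix x assume "x \<in> E"
      then have "x \<in> space M" "a * b < norm (f x) * norm (g x)"
        using \<open>0 < C\<close> by (auto simp: E_def ab norm_mult norm_divide field_simps)
      moreover have "norm (f x) * norm (g x) \<le> a * b" if "norm (f x) \<le> a" "norm (g x) \<le> b"
        using that ab by (intro mult_mono) auto
      ultimately show "x \<in> F \<union> G"
        unfolding F_def G_def by fastforce
    qed
    then have "emeasure M E \<le> emeasure M (F \<union> G)"
      by (intro emeasure_mono) auto
    also have "\<dots> \<le> emeasure M F + emeasure M G"
      by (intro emeasure_subadditive) auto
    \<comment> \<open>The doubled level \<open>2 * u\<close> pays for the two sets: each product on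
      the right is at most 1.\<close>
    finally have "2 * (u * emeasure M E) \<le> 2 * u * emeasure M F + 2 * u * emeasure M G"
      by (metis distrib_left mult.assoc mult_left_mono zero_le)
    also have "\<dots> \<le> 1 + 1"
      unfolding F_def G_def using assms ab by (intro add_mono mult_emeasure_le_1)
    finally have "2 * (u * emeasure M E) \<le> 2 * 1"
      by simp
    then show ?thesis
      by (subst (asm) ennreal_mult_le_mult_iff) auto
  qed
  show "\<Phi>2 (ennreal s) * emeasure M E \<le> 1"
  proof (rule ccontr)
    assume "\<not> ?thesis"
    then have gt: "1 < \<Phi>2 (ennreal s) * emeasure M E"
      by simp
    \<comment> \<open>Multiplication commutes with suprema, so the bounds for all smaller
      \<open>u\<close> carry over to \<open>\<Phi>2 s\<close> itself.\<close>
    have "(SUP u\<in>{..<\<Phi>2 (ennreal s)}. u * emeasure M E) =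
        (SUP u\<in>{..<\<Phi>2 (ennreal s)}. u) * emeasure M E"
      by (rule SUP_mult_right_ennreal[symmetric])
    also have "(SUP u\<in>{..<\<Phi>2 (ennreal s)}. u) = \<Phi>2 (ennreal s)"
      by simp
    finally have "1 < (SUP u\<in>{..<\<Phi>2 (ennreal s)}. u * emeasure M E)"
      using gt by simp
    then obtain u where "u < \<Phi>2 (ennreal s)" "1 < u * emeasure M E"
      by (auto simp: less_SUP_iff)
    with bound[of u] show False
      by (cases "u = 0") (auto simp: zero_less_iff_neq_zero)
  qed
qed

section \<open>Normalization and finiteness of the norm\<close>

text \<open>Membership only makes the modular of some multiple finite. By convexity, scaling the
  argument of \<Phi> down far enough divides that bound by any prescribed factor. This makes the set
  defining the norm nonempty.\<close>

lemma weak_orlicz_normalize: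
  fixes f :: "'a \<Rightarrow> 'k::{real_normed_field, euclidean_space}"
  assumes "young_function \<Phi>" and "f \<in> weak_orlicz M \<Phi>"
  obtains l where "0 < l" "weak_modular M \<Phi> (\<lambda>x. f x / of_real l) \<le> 1"
proof -
  obtain e where e: "0 < e" "weak_modular M \<Phi> (\<lambda>x. of_real e * f x) < \<infinity>"
    using assms(2) by (auto simp: weak_orlicz_def)
  then obtain K where K: "weak_modular M \<Phi> (\<lambda>x. of_real e * f x) = ennreal K" "0 \<le> K"
    by (metis ennreal_cases infinity_ennreal_def less_irrefl)
  \<comment> \<open>The maximum with 1 meets the requirement \<open>1 \<le> k\<close> of
    \<open>young_function_scale\<close>.\<close>
  define k where "k = max 1 K"
  have k: "1 \<le> k" "K \<le> k"
    by (auto simp: k_def)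
  \<comment> \<open>Here \<open>2 * k\<close> rather than \<open>k\<close> appears because
    \<open>young_function_scale\<close> gains the factor \<open>k\<close> only from a strictly
    larger dilation.\<close>
  have "weak_modular M \<Phi> (\<lambda>x. f x / of_real (2 * k / e)) \<le> 1"
    unfolding weak_modular_le_iff
  proof (intro allI impI)
    fix t :: real assume "0 < t"
    define m where "m = emeasure M {x \<in> space M. 2 * k * t < norm (of_real e * f x)}"
    have m: "emeasure M {x \<in> space M. t < norm (f x / of_real (2 * k / e))} = m"
      unfolding m_def using e k
      by (intro arg_cong[where f = "emeasure M"]) (auto simp: norm_mult norm_divide field_simps)
    have "ennreal k * (\<Phi> (ennreal t) * m) \<le> \<Phi> (ennreal (2 * k * t)) * m"
      unfolding mult.assoc[symmetric]
      using assms(1) k \<open>0 < t\<close> by (intro mult_right_mono young_function_scale) auto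
    also have "\<dots> \<le> ennreal K"
      using K k \<open>0 < t\<close> weak_modular_le_iff[of M \<Phi> "\<lambda>x. of_real e * f x" "ennreal K"]
      by (auto simp: m_def)
    also have "\<dots> \<le> ennreal k * 1"
      using k by (simp add: ennreal_leI)
    finally show "\<Phi> (ennreal t) * emeasure M {x \<in> space M. t < norm (f x / of_real (2 * k / e))} \<le> 1"
      unfolding m using k by (subst (asm) ennreal_mult_le_mult_iff) auto
  qed
  moreover have "0 < 2 * k / e"
    using e k by simp
  ultimately show thesis
    by (rule that[rotated])
qed

lemma weak_orlicz_norm_finite:
  assumes "young_function \<Phi>" and "f \<in> weak_orlicz M \<Phi>"
  shows "weak_orlicz_norm M \<Phi> f < \<infinity>"
proof -
  obtain l where "0 < l" "weak_modular M \<Phi> (\<lambda>x. f x / of_real l) \<le> 1"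
    using weak_orlicz_normalize[OF assms] .
  then have "weak_orlicz_norm M \<Phi> f \<le> ennreal l"
    unfolding weak_orlicz_norm_def by (intro Inf_lower) auto
  then show ?thesis
    by (rule order.strict_trans1) simp
qed

section \<open>Products of infima in the extended half-line\<close>

text \<open>For positive finite \<open>k\<close> one divides by \<open>k\<close>. If
  \<open>k = 0\<close>, a member of \<open>A\<close> is needed to force \<open>x = 0\<close>; if
  \<open>k\<close> were infinite, \<open>Inf A = 0\<close> would make the right side 0 although
  every \<open>k * a\<close> could be infinite.\<close>

lemma ennreal_le_mult_Inf:
  fixes x k :: ennreal
  assumes "A \<noteq> {}" "k \<noteq> \<infinity>" and "\<And>a. a \<in> A \<Longrightarrow> x \<le> k * a"
  shows "x \<le> k * Inf A"
proof (cases "k = 0")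
  case True
  with assms show ?thesis
    by auto
next
  case False
  have "x / k \<le> Inf A"
    using False assms(3) by (intro Inf_greatest divide_le_posI_ennreal) (auto simp: zero_less_iff_neq_zero)
  then have "k * (x / k) \<le> k * Inf A"
    by (rule mult_left_mono) simp
  moreover have "k * (x / k) = x"
    using ennreal_mult_divide_eq[of k x] False assms(2)
    by (simp add: ennreal_times_divide mult.commute)
  ultimately show ?thesis
    by simp
qed

text \<open>The infima are taken one at a time; finiteness of each \<open>b\<close> and of
  \<open>Inf A\<close> keeps the constant in front finite.\<close>

lemma ennreal_le_mult_Inf_Inf:
  fixes x k :: ennreal
  assumes "A \<noteq> {}" "B \<noteq> {}" "k \<noteq> \<infinity>" "\<And>b. b \<in> B \<Longrightarrow> b \<noteq> \<infinity>" "Inf A \<noteq> \<infinity>"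
    and "\<And>a b. a \<in> A \<Longrightarrow> b \<in> B \<Longrightarrow> x \<le> k * a * b"
  shows "x \<le> k * Inf A * Inf B"
proof (rule ennreal_le_mult_Inf[OF assms(2)])
  show "k * Inf A \<noteq> \<infinity>"
    using assms by (simp add: ennreal_mult_eq_top_iff)
  fix b assume b: "b \<in> B"
  have "x \<le> (k * b) * Inf A"
    using assms b by (intro ennreal_le_mult_Inf) (auto simp: ennreal_mult_eq_top_iff mult_ac)
  then show "x \<le> k * Inf A * b"
    by (simp add: mult_ac)
qed

section \<open>The product inequality and pointwise multipliers\<close>

theorem theorem3p1:
  fixes M :: "'a measure"
    and \<Phi>1 \<Phi>2 \<Phi>3 :: "ennreal \<Rightarrow> ennreal"
    and C :: real
  assumes "complete_measure M" and "sigma_finite_measure M"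
    and "young_function \<Phi>1" and "young_function \<Phi>2" and "young_function \<Phi>3"
    and "C > 0"
    and "\<forall>u. 0 < u \<and> u < \<infinity> \<longrightarrow>
           gen_inverse \<Phi>1 u * gen_inverse \<Phi>3 u \<le> ennreal C * gen_inverse \<Phi>2 u"
  shows "(\<forall>f \<in> weak_orlicz M \<Phi>1. \<forall>g \<in> weak_orlicz M \<Phi>3.
            weak_orlicz_norm M \<Phi>2 (\<lambda>x. f x * g x :: 'k::{real_normed_field, euclidean_space})
              \<le> ennreal (4 * C) * weak_orlicz_norm M \<Phi>1 f * weak_orlicz_norm M \<Phi>3 g)
       \<and> (weak_orlicz M \<Phi>3 :: ('a \<Rightarrow> 'k) set) \<subseteq> PWM M (weak_orlicz M \<Phi>1) (weak_orlicz M \<Phi>2)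
       \<and> (\<forall>g \<in> (weak_orlicz M \<Phi>3 :: ('a \<Rightarrow> 'k) set).
            PWM_norm (weak_orlicz M \<Phi>1) (weak_orlicz_norm M \<Phi>1) (weak_orlicz_norm M \<Phi>2) g
              \<le> ennreal (4 * C) * weak_orlicz_norm M \<Phi>3 g)"
proof -
  \<comment> \<open>If \<open>l\<close> and \<open>m\<close> are admissible in the norms of
    \<open>f\<close> and \<open>g\<close>, then \<open>4 * C * l * m\<close> is admissible for the
    product. Both the norm inequality and the membership of the product rest on this.\<close>
  have modular: "weak_modular M \<Phi>2 (\<lambda>x. f x * g x / of_real (4 * C * l * m)) \<le> 1"
    if "f \<in> weak_orlicz M \<Phi>1" "g \<in> weak_orlicz M \<Phi>3" "0 < l" "0 < m"
      "weak_modular M \<Phi>1 (\<lambda>x. f x / of_real l) \<le> 1"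
      "weak_modular M \<Phi>3 (\<lambda>x. g x / of_real m) \<le> 1"
    for f g :: "'a \<Rightarrow> 'k" and l m
  proof -
    have [measurable]: "f \<in> borel_measurable M" "g \<in> borel_measurable M"
      using that by (auto simp: weak_orlicz_def)
    have "weak_modular M \<Phi>2 (\<lambda>x. (f x / of_real l) * (g x / of_real m) / of_real (4 * C)) \<le> 1"
      using assms that by (intro weak_modular_mult_le_1[of \<Phi>1 _ \<Phi>3]) auto
    then show ?thesis
      by (simp add: mult_ac)
  qed
  have norm_le: "weak_orlicz_norm M \<Phi>2 (\<lambda>x. f x * g x)
      \<le> ennreal (4 * C) * weak_orlicz_norm M \<Phi>1 f * weak_orlicz_norm M \<Phi>3 g"
    if "f \<in> weak_orlicz M \<Phi>1" "g \<in> weak_orlicz M \<Phi>3" for f g :: "'a \<Rightarrow> 'k"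
    unfolding weak_orlicz_norm_def[of M \<Phi>1] weak_orlicz_norm_def[of M \<Phi>3]
  proof (rule ennreal_le_mult_Inf_Inf)
    show "{ennreal l |l. 0 < l \<and> weak_modular M \<Phi>1 (\<lambda>x. f x / of_real l) \<le> 1} \<noteq> {}"
      using weak_orlicz_normalize[OF assms(3) that(1)] by blast
    show "{ennreal l |l. 0 < l \<and> weak_modular M \<Phi>3 (\<lambda>x. g x / of_real l) \<le> 1} \<noteq> {}"
      using weak_orlicz_normalize[OF assms(5) that(2)] by blast
    show "Inf {ennreal l |l. 0 < l \<and> weak_modular M \<Phi>1 (\<lambda>x. f x / of_real l) \<le> 1} \<noteq> \<infinity>"
      using weak_orlicz_norm_finite[OF assms(3) that(1)] unfolding weak_orlicz_norm_def
      by (rule less_imp_neq)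
  next
    fix a b
    assume "a \<in> {ennreal l |l. 0 < l \<and> weak_modular M \<Phi>1 (\<lambda>x. f x / of_real l) \<le> 1}"
      and "b \<in> {ennreal l |l. 0 < l \<and> weak_modular M \<Phi>3 (\<lambda>x. g x / of_real l) \<le> 1}"
    then obtain l m where lm: "a = ennreal l" "b = ennreal m" "0 < l" "0 < m"
      "weak_modular M \<Phi>1 (\<lambda>x. f x / of_real l) \<le> 1"
      "weak_modular M \<Phi>3 (\<lambda>x. g x / of_real m) \<le> 1"
      by blast
    have "weak_orlicz_norm M \<Phi>2 (\<lambda>x. f x * g x) \<le> ennreal (4 * C * l * m)"
      unfolding weak_orlicz_norm_def[of M \<Phi>2]
      using modular[OF that lm(3-6)] lm \<open>C > 0\<close>
      by (intro Inf_lower CollectI exI[of _ "4 * C * l * m"]) auto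
    then show "weak_orlicz_norm M \<Phi>2 (\<lambda>x. f x * g x) \<le> ennreal (4 * C) * a * b"
      using lm \<open>C > 0\<close> by (simp add: ennreal_mult)
  qed auto
  have mem: "g \<in> PWM M (weak_orlicz M \<Phi>1) (weak_orlicz M \<Phi>2)"
    if g: "g \<in> weak_orlicz M \<Phi>3" for g :: "'a \<Rightarrow> 'k"
    unfolding PWM_def
  proof (intro CollectI conjI ballI)
    show [measurable]: "g \<in> borel_measurable M"
      using g by (auto simp: weak_orlicz_def)
    fix f :: "'a \<Rightarrow> 'k" assume f: "f \<in> weak_orlicz M \<Phi>1"
    then have [measurable]: "f \<in> borel_measurable M"
      by (auto simp: weak_orlicz_def)
    obtain l m where lm: "0 < l" "0 < m"
      "weak_modular M \<Phi>1 (\<lambda>x. f x / of_real l) \<le> 1"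
      "weak_modular M \<Phi>3 (\<lambda>x. g x / of_real m) \<le> 1"
      using weak_orlicz_normalize[OF assms(3) f] weak_orlicz_normalize[OF assms(5) g] by metis
    \<comment> \<open>The reciprocal of the admissible number serves as the \<epsilon> in the
      definition of \<open>weak_orlicz\<close>.\<close>
    have "weak_modular M \<Phi>2 (\<lambda>x. of_real (1 / (4 * C * l * m)) * (f x * g x)) \<le> 1"
      using modular[OF f g lm] by simp
    also have "\<dots> < \<infinity>"
      by simp
    finally show "(\<lambda>x. f x * g x) \<in> weak_orlicz M \<Phi>2"
      unfolding weak_orlicz_def using lm \<open>C > 0\<close>
      by (intro CollectI conjI exI[of _ "1 / (4 * C * l * m)"]) auto
  qed
  have "PWM_norm (weak_orlicz M \<Phi>1) (weak_orlicz_norm M \<Phi>1) (weak_orlicz_norm M \<Phi>2) g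
      \<le> ennreal (4 * C) * weak_orlicz_norm M \<Phi>3 g"
    if g: "g \<in> weak_orlicz M \<Phi>3" for g :: "'a \<Rightarrow> 'k"
  proof -
    \<comment> \<open>\<open>PWM_norm\<close> ranges over real constants only; passing to
      \<open>enn2real\<close> loses nothing because the norm of \<open>g\<close> is finite.\<close>
    define K where "K = 4 * C * enn2real (weak_orlicz_norm M \<Phi>3 g)"
    have K: "ennreal K = ennreal (4 * C) * weak_orlicz_norm M \<Phi>3 g" "0 \<le> K"
      using weak_orlicz_norm_finite[OF assms(5) g] \<open>C > 0\<close> by (simp_all add: K_def ennreal_mult)
    show ?thesis
      unfolding PWM_norm_def K(1)[symmetric]
    proof (intro Inf_lower CollectI exI[of _ K] conjI ballI refl K(2))
      fix f :: "'a \<Rightarrow> 'k" assume "f \<in> weak_orlicz M \<Phi>1"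
      then show "weak_orlicz_norm M \<Phi>2 (\<lambda>x. f x * g x) \<le> ennreal K * weak_orlicz_norm M \<Phi>1 f"
        using norm_le[OF _ g] by (simp add: K(1) mult_ac)
    qed
  qed
  with norm_le mem show ?thesis
    by blast
qed

end
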